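(* Let $G=(V,E)$ be a finite strongly connected directed graph and $s\in V$. Then $T(G,s;y)=\sum_{n\ge 0}|\mathrm{Park}_n(G,s)|\,y^n$, where $\mathrm{Park}_n(G,s)$ is the set of $G^r$-parking functions rooted at $s$ with d-level $n$.
   Context: $G$ may have loops and multiple edges. Greedoid Tutte polynomial: fix a total order $<$ on $E$. A directed path of length $k\ge0$ is $v_0e_0v_1\dots e_{k-1}v_k$ with pairwise distinct vertices and $e_i$ an edge from $v_i$ to $v_{i+1}$. An arborescence rooted at $s$ is a subgraph $T$ with vertex set $V$ such that for each $v\in V$ there is a unique directed path in $T$ from $s$ to $v$; $A(G,s)$ is their set. For $e\in E\setminus E(T)$ there are exactly two edge-disjoint directed paths $P_1,P_2$ in $(V,E(T)\cup\{e\})$ with the same starting vertex and both ending at the target of $e$, $P_1$ being the one containing $e$; $e$ is externally active if the $<$-smallest edge of $E(P_1)\cup E(P_2)$ lies in $P_1$. $e(T)$ is the number of externally active edges and $T(G,s;y)=\sum_{T\in A(G,s)}y^{e(T)}$ (independent of the order). A $G^r$-parking function rooted at $s$ is a function $f:V\setminus\{s\}\to\mathbb N_0$ such that for every nonempty $A\subseteq V\setminus\{s\}$ there is $v\in A$ with $f(v)$ smaller than the number of edges from $V\setminus A$ to $v$. Its d-level is $\mathrm{dlvl}(f)=|E|-|V|+1-\sum_{v\neq s}f(v)$.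
   Formalization: Directed paths are taken with pairwise distinct edges instead of pairwise distinct vertices, since otherwise adding an edge back into s leaves paths unique and loops or back edges have no pair P1, P2; then arborescences are the usual ones and P1 may be a closed path with P2 trivial. *)

theory Defs
  imports
    "Graph_Theory.Graph_Theory"
    "HOL-Computational_Algebra.Polynomial_FPS"
begin

text \<open>
  Digraphs with loops and multiple arcs are those of \<^locale>\<open>fin_digraph\<close>.

  Directed paths are rendered by \<^const>\<open>pre_digraph.trail\<close> (arc walks with pairwise distinct arcs),
  not by \<^const>\<open>pre_digraph.apath\<close> (pairwise distinct vertices). With vertex-distinctness the
  notions below degenerate: for the digraph with arcs \<open>a : s \<rightarrow> v\<close> and \<open>b : v \<rightarrow> s\<close>, both \<open>{a}\<close> and
  \<open>{a, b}\<close> would have unique paths from \<open>s\<close>, and a loop, or an arc whose head \<open>w\<close> precedes its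
  tail in the tree, would have no fundamental pair of paths. For such an arc the pair consists of
  the closed trail at \<open>w\<close> formed by the arc and the tree, and of the trivial trail at \<open>w\<close>.
\<close>

definition arborescences :: "('a,'b) pre_digraph \<Rightarrow> 'a \<Rightarrow> ('a,'b) pre_digraph set" where
  "arborescences G s =
     {T. spanning T G \<and> (\<forall>v\<in>verts G. \<exists>!p. pre_digraph.trail T s p v)}"

definition fundamental_paths ::
  "('a,'b) pre_digraph \<Rightarrow> ('a,'b) pre_digraph \<Rightarrow> 'b \<Rightarrow> 'b list \<Rightarrow> 'b list \<Rightarrow> bool" where
  "fundamental_paths G T e P1 P2 \<longleftrightarrow>
     (let H = G\<lparr>arcs := insert e (arcs T)\<rparr> in
       \<exists>u. pre_digraph.trail H u P1 (head G e) \<and> pre_digraph.trail H u P2 (head G e) \<and>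
           e \<in> set P1 \<and> set P1 \<inter> set P2 = {})"

text \<open>
  The order on the arcs is a reflexive linear order relation \<open>R\<close>; \<open>m\<close> is the \<open>R\<close>-smallest arc.
\<close>
definition externally_active ::
  "('a,'b) pre_digraph \<Rightarrow> 'b rel \<Rightarrow> ('a,'b) pre_digraph \<Rightarrow> 'b \<Rightarrow> bool" where
  "externally_active G R T e \<longleftrightarrow>
     e \<in> arcs G - arcs T \<and>
     (\<exists>P1 P2. fundamental_paths G T e P1 P2 \<and>
        (\<exists>m\<in>set P1. \<forall>x\<in>set P1 \<union> set P2. (m, x) \<in> R))"

definition external_activity ::
  "('a,'b) pre_digraph \<Rightarrow> 'b rel \<Rightarrow> ('a,'b) pre_digraph \<Rightarrow> nat" where
  "external_activity G R T = card {e. externally_active G R T e}"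

definition greedoid_tutte_poly :: "('a,'b) pre_digraph \<Rightarrow> 'b rel \<Rightarrow> 'a \<Rightarrow> int poly" where
  "greedoid_tutte_poly G R s = (\<Sum>T\<in>arborescences G s. monom 1 (external_activity G R T))"

text \<open>
  A function on \<open>V - {s}\<close> is represented by its extensional extension to the whole vertex type.
\<close>
definition parking_functions :: "('a,'b) pre_digraph \<Rightarrow> 'a \<Rightarrow> ('a \<Rightarrow> nat) set" where
  "parking_functions G s =
     {f \<in> (verts G - {s}) \<rightarrow>\<^sub>E UNIV.
        \<forall>A. A \<noteq> {} \<and> A \<subseteq> verts G - {s} \<longrightarrow>
          (\<exists>v\<in>A. f v < card {a \<in> arcs G. tail G a \<in> verts G - A \<and> head G a = v})}"

definition dlvl :: "('a,'b) pre_digraph \<Rightarrow> 'a \<Rightarrow> ('a \<Rightarrow> nat) \<Rightarrow> int" where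
  "dlvl G s f = int (card (arcs G)) - int (card (verts G)) + 1 - (\<Sum>v\<in>verts G - {s}. int (f v))"

definition Park :: "('a,'b) pre_digraph \<Rightarrow> 'a \<Rightarrow> nat \<Rightarrow> ('a \<Rightarrow> nat) set" where
  "Park G s n = {f \<in> parking_functions G s. dlvl G s f = int n}"

lemma finite_arborescences:
  assumes "finite (arcs G)"
  shows "finite (arborescences G s)"
proof (rule finite_subset)
  show "arborescences G s \<subseteq> (\<lambda>B. G\<lparr>arcs := B\<rparr>) ` Pow (arcs G)"
  proof
    fix T assume "T \<in> arborescences G s"
    then have T: "verts G = verts T" "arcs T \<subseteq> arcs G" "tail G = tail T" "head G = head T"
      unfolding arborescences_def spanning_def subgraph_def compatible_def by blast+
    then have "T = G\<lparr>arcs := arcs T\<rparr>" by (intro pre_digraph.equality) simp_all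
    with T(2) show "T \<in> (\<lambda>B. G\<lparr>arcs := B\<rparr>) ` Pow (arcs G)" by blast
  qed
qed (use assms in simp)

lemma (in fin_digraph) finite_parking_functions: "finite (parking_functions G s)"
proof (rule finite_subset)
  show "parking_functions G s \<subseteq> (verts G - {s}) \<rightarrow>\<^sub>E {..card (arcs G)}"
  proof (rule subsetI, rule PiE_I)
    fix f v assume f: "f \<in> parking_functions G s" and v: "v \<in> verts G - {s}"
    have "{v} \<noteq> {} \<and> {v} \<subseteq> verts G - {s}" using v by simp
    then have "\<exists>w\<in>{v}. f w < card {a \<in> arcs G. tail G a \<in> verts G - {v} \<and> head G a = w}"
      using f unfolding parking_functions_def by blast
    then have "f v < card {a \<in> arcs G. tail G a \<in> verts G - {v} \<and> head G a = v}" by simp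
    also have "\<dots> \<le> card (arcs G)" by (rule card_mono) auto
    finally show "f v \<in> {..card (arcs G)}" by simp
  next
    fix f v assume "f \<in> parking_functions G s" "v \<notin> verts G - {s}"
    then show "f v = undefined" unfolding parking_functions_def by (blast dest: PiE_arb)
  qed
qed (simp add: finite_PiE)

end

theory Submission
  imports Defs
begin

text \<open>
  Weight the arcs by powers of two, smaller arcs being heavier. Then of two disjoint arc sets
  the heavier one contains the smallest arc of the union, so activity becomes a statement about
  the weighted depth \<open>d\<close> in the arborescence: a non-tree arc \<open>e\<close> is externally inactive iff
  \<open>d (tail e) + w e < d (head e)\<close>, and equality holds exactly for the tree arcs. The parking
  function of an arborescence counts at each vertex the entering inactive arcs. Conversely, \<open>d\<close> is
  recovered from a parking function \<open>f\<close> by a variant of Dijkstra's algorithm in which a vertex \<open>v\<close>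
  is settled at the \<open>(f v + 1)\<close>-st smallest of the values \<open>d (tail a) + w a\<close> of its entering arcs.
\<close>

section \<open>Auxiliary facts on lists, finite linear orders and arc walks\<close>

lemma split_common_prefix:
  obtains ps xs' ys' where "xs = ps @ xs'" "ys = ps @ ys'"
    "xs' = [] \<or> ys' = [] \<or> hd xs' \<noteq> hd ys'"
proof -
  have "\<exists>ps xs' ys'. xs = ps @ xs' \<and> ys = ps @ ys' \<and> (xs' = [] \<or> ys' = [] \<or> hd xs' \<noteq> hd ys')"
  proof (induction xs arbitrary: ys)
    case Nil
    then show ?case by simp
  next
    case (Cons x xs)
    show ?case
    proof (cases "ys \<noteq> [] \<and> hd ys = x")
      case True
      then obtain zs where zs: "ys = x # zs" by (cases ys) auto
      obtain ps xs' ys' where "xs = ps @ xs'" "zs = ps @ ys'"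
        "xs' = [] \<or> ys' = [] \<or> hd xs' \<noteq> hd ys'"
        using Cons.IH[of zs] by blast
      then show ?thesis using zs by (intro exI[of _ "x # ps"] exI[of _ xs'] exI[of _ ys']) simp
    next
      case False
      then show ?thesis by (intro exI[of _ "[]"] exI[of _ "x # xs"] exI[of _ ys]) auto
    qed
  qed
  then show ?thesis using that by blast
qed

lemma linear_order_on_finite_has_least:
  assumes "linear_order_on A R" "finite B" "B \<noteq> {}" "B \<subseteq> A"
  shows "\<exists>m\<in>B. \<forall>x\<in>B. (m, x) \<in> R"
  using assms(2-4)
proof (induction B rule: finite_ne_induct)
  case (singleton x)
  then show ?case using assms(1) by (auto simp: order_on_defs refl_on_def)
next
  case (insert x F)
  then obtain m where m: "m \<in> F" "\<forall>y\<in>F. (m, y) \<in> R" by auto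
  have xx: "(x, x) \<in> R" and tr: "trans R"
    using assms(1) insert.prems by (auto simp: order_on_defs refl_on_def)
  have "(m, x) \<in> R \<or> (x, m) \<in> R"
    using assms(1) insert m(1) by (auto simp: order_on_defs total_on_def)
  then show ?case using m xx tr by (auto dest: transD)
qed

text \<open>\<open>cas\<close> looks only at tails and heads, so changing the arc set affects
  nothing but the membership of the arcs. Trails in subgraphs thus become statements about arc sets
  in one fixed digraph.\<close>

lemma (in pre_digraph) trail_arcs_update_iff:
  "pre_digraph.trail (G\<lparr>arcs := B\<rparr>) u p v \<longleftrightarrow>
     u \<in> verts G \<and> set p \<subseteq> B \<and> cas u p v \<and> distinct p"
proof -
  have "compatible G (G\<lparr>arcs := B\<rparr>)" by (simp add: compatible_def)
  from compatible_cas[OF this] show ?thesis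
    by (auto simp: pre_digraph.trail_def pre_digraph.awalk_def)
qed

lemma (in pre_digraph) cas_snoc_iff:
  "cas u (p @ [a]) v \<longleftrightarrow> cas u p (tail G a) \<and> head G a = v"
  by (induction p arbitrary: u) (auto simp del: cas_append_iff)

lemma (in pre_digraph) sum_list_cas_telescope:
  fixes d :: "'a \<Rightarrow> int"
  assumes "cas u p v"
  shows "(\<Sum>a\<leftarrow>p. d (head G a) - d (tail G a)) = d v - d u"
  using assms by (induction p arbitrary: u) auto

locale ordered_rooted_digraph = fin_digraph G for G :: "('a, 'b) pre_digraph" +
  fixes s :: 'a and R :: "'b rel"
  assumes root_in_verts: "s \<in> verts G"
    and linear_order: "linear_order_on (arcs G) R"
begin

subsection \<open>Arc weights\<close>

text \<open>For an arc \<open>a\<close> the exponent counts the arcs from \<open>a\<close> upwards,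
  so distinct arcs have distinct exponents and the \<open>R\<close>-smallest arc has the largest
  one.\<close>

definition weight :: "'b \<Rightarrow> nat" where
  "weight a = 2 ^ card {b. (a, b) \<in> R}"

lemma weight_pos [simp]: "0 < weight a"
  by (simp add: weight_def)

lemma R_subset: "R \<subseteq> arcs G \<times> arcs G"
  using linear_order by (simp add: order_on_defs)

lemma finite_R_above: "finite {b. (a, b) \<in> R}"
  by (rule finite_subset[OF _ finite_arcs]) (use R_subset in auto)

lemma card_R_above_less:
  assumes "(a, b) \<in> R" "a \<noteq> b"
  shows "card {x. (b, x) \<in> R} < card {x. (a, x) \<in> R}"
proof (rule psubset_card_mono[OF finite_R_above])
  have R: "refl_on (arcs G) R" "trans R" "antisym R" using linear_order by (auto simp: order_on_defs)
  then have "a \<in> {x. (a, x) \<in> R}" using assms R_subset by (auto simp: refl_on_def)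
  moreover have "a \<notin> {x. (b, x) \<in> R}" using assms R(3) by (auto dest: antisymD)
  moreover have "{x. (b, x) \<in> R} \<subseteq> {x. (a, x) \<in> R}" using assms R(2) by (auto dest: transD)
  ultimately show "{x. (b, x) \<in> R} \<subset> {x. (a, x) \<in> R}" by blast
qed

text \<open>The exponents in \<open>B\<close> are distinct and below that of \<open>m\<close>, and
  \<open>2^0 + ... + 2^(r-1) < 2^r\<close>, so \<open>m\<close> alone outweighs
  \<open>B\<close>.\<close>

lemma sum_weight_less:
  assumes "A \<subseteq> arcs G" "B \<subseteq> arcs G" "A \<inter> B = {}" "m \<in> A" "\<forall>x\<in>A \<union> B. (m, x) \<in> R"
  shows "sum weight B < sum weight A"
proof -
  define r where "r = (\<lambda>a. card {x. (a, x) \<in> R})"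
  have "inj_on r B"
  proof (rule inj_onI, rule ccontr)
    fix a b assume ab: "a \<in> B" "b \<in> B" "r a = r b" "a \<noteq> b"
    then have "(a, b) \<in> R \<or> (b, a) \<in> R"
      using linear_order assms(2) by (auto simp: order_on_defs total_on_def)
    then show False using ab card_R_above_less[of a b] card_R_above_less[of b a]
      by (auto simp: r_def)
  qed
  then have "sum weight B = (\<Sum>i\<in>r ` B. 2 ^ i)"
    by (simp add: sum.reindex weight_def r_def)
  also have "\<dots> \<le> (\<Sum>i<r m. 2 ^ i)"
  proof (rule sum_mono2)
    have "r b < r m" if "b \<in> B" for b
      unfolding r_def by (rule card_R_above_less) (use that assms in auto)
    then show "r ` B \<subseteq> {..<r m}" by auto
  qed auto
  also have "\<dots> < 2 ^ r m"
    by (simp add: lessThan_atLeast0 sum_power2)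
  also have "\<dots> = weight m" by (simp add: weight_def r_def)
  also have "\<dots> \<le> sum weight A"
    by (rule member_le_sum) (use assms finite_subset[OF assms(1)] in auto)
  finally show ?thesis .
qed

subsection \<open>Threshold potentials\<close>

text \<open>Ranging over all bounds \<open>k\<close> expresses an order statistic of the arrival
  values, with multiplicity, without sorting them.\<close>

definition threshold_potential :: "('a \<Rightarrow> nat) \<Rightarrow> ('a \<Rightarrow> nat) \<Rightarrow> bool" where
  "threshold_potential f d \<longleftrightarrow> d s = 0 \<and>
     (\<forall>v\<in>verts G - {s}. \<forall>k.
        d v \<le> k \<longleftrightarrow> f v < card {a \<in> arcs G. head G a = v \<and> d (tail G a) + weight a \<le> k})"

text \<open>Weights are positive, so whether an arc is counted at bound \<open>k\<close> depends on
  the potential of its tail at a strictly smaller bound. Induction on \<open>k\<close> serves all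
  vertices at once.\<close>

lemma threshold_potential_unique:
  assumes "threshold_potential f d" "threshold_potential f d'" "v \<in> verts G"
  shows "d v = d' v"
proof -
  have "d v \<le> k \<longleftrightarrow> d' v \<le> k" if "v \<in> verts G" for v k
    using that
  proof (induction k arbitrary: v rule: less_induct)
    case (less k)
    show ?case
    proof (cases "v = s")
      case True
      then show ?thesis using assms by (simp add: threshold_potential_def)
    next
      case False
      have "d (tail G a) + weight a \<le> k \<longleftrightarrow> d' (tail G a) + weight a \<le> k"
        if "a \<in> arcs G" for a
      proof (cases "weight a \<le> k")
        case True
        then have "k - weight a < k" using weight_pos[of a] by linarith
        then have "d (tail G a) \<le> k - weight a \<longleftrightarrow> d' (tail G a) \<le> k - weight a"
          using less.IH that by simp
        then show ?thesis using True by linarith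
      qed simp
      then have "{a \<in> arcs G. head G a = v \<and> d (tail G a) + weight a \<le> k} =
          {a \<in> arcs G. head G a = v \<and> d' (tail G a) + weight a \<le> k}"
        by blast
      then show ?thesis using assms(1,2) False less.prems
        by (simp add: threshold_potential_def)
    qed
  qed
  then show ?thesis using assms(3) by (meson order_antisym order_refl)
qed

text \<open>\<open>settled f k v\<close> stands for \<open>d v \<le> k\<close> before
  \<open>d\<close> is available. A witnessing set \<open>A\<close> in place of the cardinality of a
  comprehension keeps the rule visibly monotone.\<close>

inductive settled :: "('a \<Rightarrow> nat) \<Rightarrow> nat \<Rightarrow> 'a \<Rightarrow> bool" for f where
  root: "settled f k s"
| step: "\<lbrakk>A \<subseteq> {a \<in> arcs G. head G a = v}; f v < card A;
    \<forall>a\<in>A. weight a \<le> k \<and> settled f (k - weight a) (tail G a)\<rbrakk> \<Longrightarrow> settled f k v"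

lemma settled_mono:
  assumes "settled f k v" "k \<le> k'"
  shows "settled f k' v"
  using assms
proof (induction arbitrary: k')
  case (root k)
  show ?case by (rule settled.root)
next
  case (step A v k)
  then have "\<forall>a\<in>A. weight a \<le> k' \<and> settled f (k' - weight a) (tail G a)"
    by (meson diff_le_mono order_trans)
  then show ?case using step.hyps by (blast intro: settled.step)
qed

text \<open>If the set \<open>A\<close> of never settled vertices were nonempty, the parking
  condition would give some \<open>u\<close> in it more than \<open>f u\<close> arcs from settled
  vertices, and \<open>u\<close> would settle too.\<close>

lemma parking_settled:
  assumes "f \<in> parking_functions G s" "v \<in> verts G"
  shows "\<exists>k. settled f k v"
proof (rule ccontr)
  define A where "A = {v \<in> verts G. \<nexists>k. settled f k v}"
  assume "\<nexists>k. settled f k v"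
  then have "A \<noteq> {}" "A \<subseteq> verts G - {s}"
    using assms(2) settled.root by (auto simp: A_def)
  then obtain u where u: "u \<in> A"
    "f u < card {a \<in> arcs G. tail G a \<in> verts G - A \<and> head G a = u}" (is "_ < card ?B")
    using assms(1) unfolding parking_functions_def by blast
  have "\<forall>a\<in>?B. \<exists>k. settled f k (tail G a)" by (auto simp: A_def)
  then obtain g where g: "\<forall>a\<in>?B. settled f (g a) (tail G a)" by metis
  define k where "k = (\<Sum>a\<in>?B. g a + weight a)"
  have "g a + weight a \<le> k" if "a \<in> ?B" for a
    unfolding k_def by (rule member_le_sum[OF that]) auto
  then have "\<forall>a\<in>?B. weight a \<le> k \<and> settled f (k - weight a) (tail G a)"
    using g settled_mono by (metis (no_types, lifting) add_leD2 le_diff_conv2)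
  then have "settled f k u" using u(2) by (intro settled.step[of ?B]) auto
  then show False using u(1) by (auto simp: A_def)
qed

text \<open>Take the first settling time. By monotonicity \<open>d v \<le> k\<close> means
  \<open>settled f k v\<close>, and the two directions of the threshold condition are inversion and
  application of \<open>settled.step\<close>.\<close>

lemma threshold_potential_exists:
  assumes "f \<in> parking_functions G s"
  obtains d where "threshold_potential f d"
proof
  define d where "d = (\<lambda>v. LEAST k. settled f k v)"
  have d: "d v \<le> k \<longleftrightarrow> settled f k v" if "v \<in> verts G" for v k
    unfolding d_def using parking_settled[OF assms that]
    by (meson LeastI_ex Least_le settled_mono)
  have "d v \<le> k \<longleftrightarrow> f v < card {a \<in> arcs G. head G a = v \<and> d (tail G a) + weight a \<le> k}"
    (is "_ \<longleftrightarrow> _ < card ?B") if v: "v \<in> verts G - {s}" for v k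
  proof
    assume "d v \<le> k"
    then have "settled f k v" using d v by blast
    then obtain A where A: "A \<subseteq> {a \<in> arcs G. head G a = v}" "f v < card A"
      "\<forall>a\<in>A. weight a \<le> k \<and> settled f (k - weight a) (tail G a)"
      using v by cases auto
    have "A \<subseteq> ?B"
    proof
      fix a assume a: "a \<in> A"
      then have "weight a \<le> k" "d (tail G a) \<le> k - weight a" using A d by auto
      then show "a \<in> ?B" using A(1) a by auto
    qed
    then have "card A \<le> card ?B" by (intro card_mono) auto
    then show "f v < card ?B" using A(2) by linarith
  next
    assume "f v < card ?B"
    moreover have "\<forall>a\<in>?B. weight a \<le> k \<and> settled f (k - weight a) (tail G a)"
      using d[symmetric] by auto
    ultimately have "settled f k v" by (intro settled.step[of ?B]) auto
    then show "d v \<le> k" using d v by blast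
  qed
  moreover have "d s \<le> 0" using d root_in_verts settled.root by blast
  ultimately show "threshold_potential f d" by (simp add: threshold_potential_def)
qed

subsection \<open>Weighted depth in an arborescence\<close>

definition tree_arcs :: "'b set \<Rightarrow> bool" where
  "tree_arcs B \<longleftrightarrow> B \<subseteq> arcs G \<and>
     (\<forall>v\<in>verts G. \<exists>!p. set p \<subseteq> B \<and> cas s p v \<and> distinct p)"

lemma arborescences_eq: "arborescences G s = (\<lambda>B. G\<lparr>arcs := B\<rparr>) ` {B. tree_arcs B}"
proof (intro equalityI subsetI)
  fix T assume T: "T \<in> arborescences G s"
  then have "verts G = verts T" "arcs T \<subseteq> arcs G" "tail G = tail T" "head G = head T"
    unfolding arborescences_def spanning_def subgraph_def compatible_def by blast+
  then have T_eq: "T = G\<lparr>arcs := arcs T\<rparr>"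
    by (intro pre_digraph.equality) simp_all
  have "\<forall>v\<in>verts G. \<exists>!p. pre_digraph.trail (G\<lparr>arcs := arcs T\<rparr>) s p v"
    using T T_eq by (simp add: arborescences_def)
  with \<open>arcs T \<subseteq> arcs G\<close> have "tree_arcs (arcs T)"
    by (simp add: tree_arcs_def trail_arcs_update_iff root_in_verts)
  with T_eq show "T \<in> (\<lambda>B. G\<lparr>arcs := B\<rparr>) ` {B. tree_arcs B}" by blast
next
  fix T assume "T \<in> (\<lambda>B. G\<lparr>arcs := B\<rparr>) ` {B. tree_arcs B}"
  then obtain B where B: "tree_arcs B" and T: "T = G\<lparr>arcs := B\<rparr>" by blast
  have "B \<subseteq> arcs G" using B by (simp add: tree_arcs_def)
  then have "wf_digraph (G\<lparr>arcs := B\<rparr>)" by unfold_locales auto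
  then have "spanning T G"
    using \<open>B \<subseteq> arcs G\<close> wf_digraph by (auto simp: T spanning_def subgraph_def compatible_def)
  moreover have "\<forall>v\<in>verts G. \<exists>!p. pre_digraph.trail T s p v"
    using B by (simp add: T trail_arcs_update_iff root_in_verts tree_arcs_def)
  ultimately show "T \<in> arborescences G s" by (simp add: arborescences_def)
qed

definition tree_path :: "'b set \<Rightarrow> 'a \<Rightarrow> 'b list" where
  "tree_path B v = (THE p. set p \<subseteq> B \<and> cas s p v \<and> distinct p)"

definition depth :: "'b set \<Rightarrow> 'a \<Rightarrow> nat" where
  "depth B v = sum weight (set (tree_path B v))"

lemma
  assumes "tree_arcs B" "v \<in> verts G"
  shows tree_path_subset: "set (tree_path B v) \<subseteq> B"
    and cas_tree_path: "cas s (tree_path B v) v"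
    and distinct_tree_path: "distinct (tree_path B v)"
proof -
  have "\<exists>!p. set p \<subseteq> B \<and> cas s p v \<and> distinct p"
    using assms by (simp add: tree_arcs_def)
  from theI'[OF this] show "set (tree_path B v) \<subseteq> B" "cas s (tree_path B v) v"
    "distinct (tree_path B v)"
    unfolding tree_path_def by blast+
qed

lemma tree_path_unique:
  assumes "tree_arcs B" "v \<in> verts G" "set p \<subseteq> B" "cas s p v" "distinct p"
  shows "p = tree_path B v"
  unfolding tree_path_def
  by (rule the1_equality[symmetric]) (use assms in \<open>simp_all add: tree_arcs_def\<close>)

lemma tree_path_root [simp]:
  assumes "tree_arcs B"
  shows "tree_path B s = []"
  using tree_path_unique[OF assms root_in_verts, of "[]"] by simp

lemma depth_root [simp]: "tree_arcs B \<Longrightarrow> depth B s = 0"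
  by (simp add: depth_def)

text \<open>If \<open>a\<close> occurred on the tree path to its own tail, the part before
  \<open>a\<close> would be a second trail to that vertex. So appending \<open>a\<close> keeps the
  arcs distinct and uniqueness applies.\<close>

lemma tree_path_head:
  assumes B: "tree_arcs B" and a: "a \<in> B"
  shows "tree_path B (head G a) = tree_path B (tail G a) @ [a]"
    and "a \<notin> set (tree_path B (tail G a))"
proof -
  have aG: "a \<in> arcs G" using B a by (auto simp: tree_arcs_def)
  let ?p = "tree_path B (tail G a)"
  have p: "set ?p \<subseteq> B" "cas s ?p (tail G a)" "distinct ?p"
    using tree_path_subset cas_tree_path distinct_tree_path B aG by auto
  show na: "a \<notin> set ?p"
  proof
    assume "a \<in> set ?p"
    then obtain p1 p2 where p12: "?p = p1 @ a # p2" by (auto simp: in_set_conv_decomp)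
    then have "p1 = ?p"
      by (intro tree_path_unique[OF B tail_in_verts[OF aG]]) (use p in auto)
    then show False using p12 by simp
  qed
  show "tree_path B (head G a) = ?p @ [a]"
    using p na a B aG
    by (intro tree_path_unique[symmetric]) (simp_all add: cas_snoc_iff del: cas_append_iff)
qed

lemma depth_head:
  assumes "tree_arcs B" "a \<in> B"
  shows "depth B (head G a) = depth B (tail G a) + weight a"
  using tree_path_head[OF assms] by (simp add: depth_def)

text \<open>The inverse sends a vertex to the last arc of its tree path. No tree arc enters
  \<open>s\<close>, since the head of a tree arc has positive depth.\<close>

lemma bij_betw_head_tree_arcs:
  assumes B: "tree_arcs B"
  shows "bij_betw (head G) B (verts G - {s})"
proof (rule bij_betwI')
  fix a b assume "a \<in> B" "b \<in> B"
  then show "head G a = head G b \<longleftrightarrow> a = b"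
    using tree_path_head(1)[OF B] by (metis last_snoc)
next
  fix a assume a: "a \<in> B"
  then have "head G a \<in> verts G" using B by (auto simp: tree_arcs_def)
  moreover have "head G a \<noteq> s"
    using depth_head[OF B a] depth_root[OF B] by (metis add_is_0 weight_pos less_irrefl)
  ultimately show "head G a \<in> verts G - {s}" by simp
next
  fix v assume v: "v \<in> verts G - {s}"
  then have p: "set (tree_path B v) \<subseteq> B" "cas s (tree_path B v) v"
    using tree_path_subset cas_tree_path B by auto
  show "\<exists>a\<in>B. v = head G a"
  proof (cases "tree_path B v" rule: rev_cases)
    case Nil
    then show ?thesis using p v by simp
  next
    case (snoc ys y)
    then show ?thesis using p by auto
  qed
qed

lemma sum_weight_trail:
  assumes "tree_arcs B" "set p \<subseteq> B" "cas u p v" "distinct p"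
  shows "int (sum weight (set p)) = int (depth B v) - int (depth B u)"
proof -
  have "int (sum weight (set p)) =
      (\<Sum>a\<in>set p. int (depth B (head G a)) - int (depth B (tail G a)))"
    using assms(1,2) by (auto simp: depth_head subset_iff intro!: sum.cong)
  then show ?thesis
    using assms(4) sum_list_cas_telescope[OF assms(3), of "\<lambda>x. int (depth B x)"]
    by (simp add: sum_list_distinct_conv_sum_set)
qed

text \<open>A trail meets \<open>e\<close> only once; cutting there leaves two trails in
  \<open>B\<close>, and the last bracket is the amount by which \<open>e\<close> deviates from a
  tree arc.\<close>

lemma sum_weight_trail_insert:
  assumes "tree_arcs B" "set p \<subseteq> insert e B" "cas u p v" "distinct p" "e \<in> set p" "e \<notin> B"
  shows "int (sum weight (set p)) = int (depth B v) - int (depth B u) +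
    (int (depth B (tail G e)) + int (weight e) - int (depth B (head G e)))"
proof -
  obtain p1 p2 where p: "p = p1 @ e # p2" using assms(5) by (auto simp: in_set_conv_decomp)
  then have p12: "set p1 \<subseteq> B" "cas u p1 (tail G e)" "distinct p1"
    "set p2 \<subseteq> B" "cas (head G e) p2 v" "distinct p2"
    using assms by auto
  note sum_weight_trail[OF assms(1) p12(1-3)] sum_weight_trail[OF assms(1) p12(4-6)]
  moreover have "sum weight (set p) = sum weight (set p1) + weight e + sum weight (set p2)"
    using assms(4) by (simp add: p sum.union_disjoint)
  ultimately show ?thesis by linarith
qed

subsection \<open>External activity\<close>

lemma fundamental_paths_iff:
  "fundamental_paths G (G\<lparr>arcs := B\<rparr>) e P1 P2 \<longleftrightarrow>
     (\<exists>u\<in>verts G. set P1 \<subseteq> insert e B \<and> cas u P1 (head G e) \<and> distinct P1 \<and>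
        set P2 \<subseteq> insert e B \<and> cas u P2 (head G e) \<and> distinct P2 \<and>
        e \<in> set P1 \<and> set P1 \<inter> set P2 = {})"
  by (simp add: fundamental_paths_def trail_arcs_update_iff Bex_def) blast

text \<open>
  The difference of the two weights does not depend on the common start vertex, which is why
  uniqueness of the fundamental pair is never needed.
\<close>
lemma fundamental_paths_weight:
  assumes "tree_arcs B" "e \<notin> B" "fundamental_paths G (G\<lparr>arcs := B\<rparr>) e P1 P2"
  shows "sum weight (set P2) + depth B (tail G e) + weight e =
    sum weight (set P1) + depth B (head G e)"
proof -
  obtain u where u: "set P1 \<subseteq> insert e B" "cas u P1 (head G e)" "distinct P1"
    "set P2 \<subseteq> insert e B" "cas u P2 (head G e)" "distinct P2"
    "e \<in> set P1" "set P1 \<inter> set P2 = {}"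
    using assms(3) by (auto simp: fundamental_paths_iff)
  then have "set P2 \<subseteq> B" by auto
  from sum_weight_trail[OF assms(1) this u(5,6)]
    sum_weight_trail_insert[OF assms(1) u(1-3,7) assms(2)]
  show ?thesis by linarith
qed

text \<open>Follow the tree to \<open>tail G e\<close> and then \<open>e\<close>, compare with the
  tree path to \<open>head G e\<close>, and delete the common prefix. \<open>P2\<close> is empty if
  the second path is a prefix of the first, as for a loop.\<close>

lemma fundamental_paths_exist:
  assumes B: "tree_arcs B" and e: "e \<in> arcs G - B"
  obtains P1 P2 where "fundamental_paths G (G\<lparr>arcs := B\<rparr>) e P1 P2"
proof -
  let ?p = "tree_path B (tail G e)" and ?q = "tree_path B (head G e)"
  have p: "set ?p \<subseteq> B" "cas s ?p (tail G e)" "distinct ?p"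
    and q: "set ?q \<subseteq> B" "cas s ?q (head G e)" "distinct ?q"
    using tree_path_subset cas_tree_path distinct_tree_path B e by auto
  obtain ps P1 P2 where P: "?p @ [e] = ps @ P1" "?q = ps @ P2"
    "P1 = [] \<or> P2 = [] \<or> hd P1 \<noteq> hd P2"
    by (rule split_common_prefix[of "?p @ [e]" ?q])
  have "P1 \<noteq> []"
  proof
    assume "P1 = []"
    then have "e \<in> set ?q" using P(1,2) by (metis Un_iff append_Nil2 in_set_conv_decomp set_append)
    then show False using q(1) e by blast
  qed
  then obtain xs where xs: "P1 = xs @ [e]" "?p = ps @ xs"
    using P(1) by (cases P1 rule: rev_cases) auto
  obtain u where u: "cas s ps u" "cas u P2 (head G e)" "cas u xs (tail G e)"
    using q(2) p(2) unfolding P(2) xs(2) cas_append_iff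
    by (metis cas_append_iff awlast_if_cas)
  have "u \<in> verts G"
  proof -
    have "awalk s ps u"
      using u(1) root_in_verts q(1) P(2) B by (auto simp: awalk_def tree_arcs_def)
    then show ?thesis by (rule awalk_last_in_verts)
  qed
  have disj: "set xs \<inter> set P2 = {}"
  proof (rule ccontr)
    assume "set xs \<inter> set P2 \<noteq> {}"
    then obtain a where "a \<in> set xs" "a \<in> set P2" by blast
    then obtain x1 x2 y1 y2 where a: "xs = x1 @ a # x2" "P2 = y1 @ a # y2"
      by (meson split_list)
    then have "a \<in> B" using q(1) P(2) by auto
    then have "a \<in> arcs G" using B by (auto simp: tree_arcs_def)
    \<comment> \<open>Uniqueness of the tree path to the tail of a shared arc \<open>a\<close> makes
      the two prefixes before \<open>a\<close> agree, so \<open>P1\<close> and \<open>P2\<close>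
      would start with the same arc.\<close>
    have "ps @ x1 = tree_path B (tail G a)"
      by (rule tree_path_unique[OF B tail_in_verts[OF \<open>a \<in> arcs G\<close>]]) (use p xs(2) a(1) in auto)
    moreover have "ps @ y1 = tree_path B (tail G a)"
      by (rule tree_path_unique[OF B tail_in_verts[OF \<open>a \<in> arcs G\<close>]]) (use q P(2) a(2) in auto)
    ultimately have "x1 = y1" by (metis same_append_eq)
    then have "hd P1 = hd P2" using xs(1) a by (cases y1) auto
    then show False using P(3) \<open>P1 \<noteq> []\<close> a(2) by simp
  qed
  have "fundamental_paths G (G\<lparr>arcs := B\<rparr>) e P1 P2"
    unfolding fundamental_paths_iff
  proof (intro bexI[of _ u] conjI)
    show "cas u P1 (head G e)"
      using u(3) by (simp add: xs(1) cas_snoc_iff del: cas_append_iff)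
  qed (use \<open>u \<in> verts G\<close> u(2) p q e disj xs P(2) in auto)
  then show ?thesis by (rule that)
qed

text \<open>The smallest arc of the union lies in exactly one of the two paths and makes that path
  strictly heavier; the weight identity for fundamental pairs turns this into depths. A tie never
  occurs, hence the second claim.\<close>

lemma fundamental_paths_active_iff:
  assumes "tree_arcs B" "e \<in> arcs G - B" "fundamental_paths G (G\<lparr>arcs := B\<rparr>) e P1 P2"
  shows "(\<exists>m\<in>set P1. \<forall>x\<in>set P1 \<union> set P2. (m, x) \<in> R) \<longleftrightarrow>
      depth B (head G e) < depth B (tail G e) + weight e" (is "?act \<longleftrightarrow> _")
    and "depth B (head G e) \<noteq> depth B (tail G e) + weight e"
proof -
  have P: "set P1 \<subseteq> arcs G" "set P2 \<subseteq> arcs G" "set P1 \<inter> set P2 = {}" "e \<in> set P1"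
    using assms by (auto simp: fundamental_paths_iff tree_arcs_def)
  have w: "sum weight (set P2) + depth B (tail G e) + weight e =
      sum weight (set P1) + depth B (head G e)"
    using assms by (intro fundamental_paths_weight) auto
  obtain m where m: "m \<in> set P1 \<union> set P2" "\<forall>x\<in>set P1 \<union> set P2. (m, x) \<in> R"
    using linear_order_on_finite_has_least[OF linear_order, of "set P1 \<union> set P2"] P by auto
  have active: "sum weight (set P2) < sum weight (set P1)" if ?act
    using that sum_weight_less[OF P(1-3)] by blast
  have inactive: "sum weight (set P1) < sum weight (set P2)" if "\<not> ?act"
  proof -
    have "m \<in> set P2" using that m by blast
    then show ?thesis using sum_weight_less[OF P(2,1), of m] P(3) m(2) by blast
  qed
  show "?act \<longleftrightarrow> depth B (head G e) < depth B (tail G e) + weight e"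
    using active inactive w by (cases ?act) auto
  show "depth B (head G e) \<noteq> depth B (tail G e) + weight e"
    using active inactive w by (cases ?act) auto
qed

text \<open>Recovers the tree from its depth function: off the tree, the two paths of a fundamental
  pair have different weights, which excludes equality.\<close>

lemma depth_head_eq_iff:
  assumes "tree_arcs B" "a \<in> arcs G"
  shows "depth B (head G a) = depth B (tail G a) + weight a \<longleftrightarrow> a \<in> B"
proof (cases "a \<in> B")
  case True
  then show ?thesis using depth_head[OF assms(1)] by simp
next
  case False
  then have "a \<in> arcs G - B" using assms(2) by simp
  then show ?thesis
    using False fundamental_paths_exist[OF assms(1)] fundamental_paths_active_iff(2)[OF assms(1)]
    by metis
qed

text \<open>Activity asks for some fundamental pair with the right minimum, but every pair gives the
  same depth condition. Tree arcs give equality of depths, so the strict inequality already excludes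
  them.\<close>

lemma externally_active_iff:
  assumes "tree_arcs B"
  shows "externally_active G R (G\<lparr>arcs := B\<rparr>) e \<longleftrightarrow>
    e \<in> arcs G \<and> depth B (head G e) < depth B (tail G e) + weight e"
proof (cases "e \<in> arcs G - B")
  case True
  then obtain P1 P2 where "fundamental_paths G (G\<lparr>arcs := B\<rparr>) e P1 P2"
    using fundamental_paths_exist[OF assms] by blast
  moreover have "externally_active G R (G\<lparr>arcs := B\<rparr>) e \<longleftrightarrow>
      (\<exists>P1 P2. fundamental_paths G (G\<lparr>arcs := B\<rparr>) e P1 P2 \<and>
        depth B (head G e) < depth B (tail G e) + weight e)"
    using True fundamental_paths_active_iff(1)[OF assms True]
    by (simp add: externally_active_def cong: conj_cong)
  ultimately show ?thesis using True by blast
next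
  case False
  then show ?thesis using depth_head[OF assms, of e] by (auto simp: externally_active_def)
qed

subsection \<open>The bijection\<close>

text \<open>When \<open>tree_arcs B\<close> holds, these are the arcs entering \<open>v\<close> that
  are neither in the tree nor externally active.\<close>

definition inactive_in :: "'b set \<Rightarrow> 'a \<Rightarrow> 'b set" where
  "inactive_in B v =
     {a \<in> arcs G. head G a = v \<and> depth B (tail G a) + weight a < depth B v}"

definition parking_of :: "'b set \<Rightarrow> 'a \<Rightarrow> nat" where
  "parking_of B = restrict (\<lambda>v. card (inactive_in B v)) (verts G - {s})"

lemma tree_arc_into:
  assumes "tree_arcs B" "v \<in> verts G - {s}"
  obtains a where "a \<in> B" "head G a = v"
proof -
  have "v \<in> head G ` B"
    using bij_betw_imp_surj_on[OF bij_betw_head_tree_arcs[OF assms(1)]] assms(2) by simp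
  then show ?thesis using that by blast
qed

text \<open>For \<open>k\<close> below \<open>depth B v\<close> every counted arc is inactive. From
  \<open>k = depth B v\<close> on, all inactive arcs into \<open>v\<close> are counted and the tree
  arc into \<open>v\<close> as well, which makes the count exceed their number.\<close>

lemma threshold_potential_depth:
  assumes B: "tree_arcs B"
  shows "threshold_potential (parking_of B) (depth B)"
  unfolding threshold_potential_def
proof (intro conjI ballI allI)
  fix v k assume v: "v \<in> verts G - {s}"
  let ?A = "{a \<in> arcs G. head G a = v \<and> depth B (tail G a) + weight a \<le> k}"
  obtain b where b: "b \<in> B" "head G b = v" using tree_arc_into[OF B v] .
  have bG: "b \<in> arcs G" using B b by (auto simp: tree_arcs_def)
  have db: "depth B v = depth B (tail G b) + weight b" using depth_head[OF B b(1)] b(2) by simp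
  show "depth B v \<le> k \<longleftrightarrow> parking_of B v < card ?A"
  proof
    assume k: "depth B v \<le> k"
    have "inactive_in B v \<subset> ?A"
    proof (rule psubsetI)
      show "inactive_in B v \<subseteq> ?A" using k by (auto simp: inactive_in_def)
      have "b \<in> ?A" "b \<notin> inactive_in B v" using bG b db k by (auto simp: inactive_in_def)
      then show "inactive_in B v \<noteq> ?A" by blast
    qed
    then show "parking_of B v < card ?A"
      using v by (auto simp: parking_of_def intro!: psubset_card_mono)
  next
    assume less: "parking_of B v < card ?A"
    show "depth B v \<le> k"
    proof (rule ccontr)
      assume "\<not> depth B v \<le> k"
      then have "?A \<subseteq> inactive_in B v" by (auto simp: inactive_in_def)
      then have "card ?A \<le> card (inactive_in B v)"
        by (intro card_mono) (auto simp: inactive_in_def)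
      then show False using less v by (simp add: parking_of_def)
    qed
  qed
qed (use B in simp)

lemma parking_of_mem:
  assumes B: "tree_arcs B"
  shows "parking_of B \<in> parking_functions G s"
  unfolding parking_functions_def
proof (intro CollectI conjI allI impI)
  show "parking_of B \<in> (verts G - {s}) \<rightarrow>\<^sub>E UNIV" by (simp add: parking_of_def)
next
  fix A assume A: "A \<noteq> {} \<and> A \<subseteq> verts G - {s}"
  then have "finite A" using finite_subset[OF _ finite_verts] by blast
  \<comment> \<open>A vertex of least depth in \<open>A\<close> is the witness: arcs with arrival
    value at most \<open>depth B v\<close> have strictly shallower tails, which lie outside
    \<open>A\<close>.\<close>
  with A obtain v where v: "v \<in> A" "\<forall>u\<in>A. depth B v \<le> depth B u"
    by (metis arg_min_if_finite(1) arg_min_least)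
  let ?C = "{a \<in> arcs G. tail G a \<in> verts G - A \<and> head G a = v}"
  have "{a \<in> arcs G. head G a = v \<and> depth B (tail G a) + weight a \<le> depth B v} \<subseteq> ?C"
    (is "?D \<subseteq> _")
  proof
    fix a assume a: "a \<in> ?D"
    then have "depth B (tail G a) + weight a \<le> depth B v" by simp
    then have "depth B (tail G a) < depth B v"
      using weight_pos[of a] by linarith
    then show "a \<in> ?C" using a v(2) by (auto simp: not_le[symmetric])
  qed
  then have "card ?D \<le> card ?C" by (intro card_mono) auto
  moreover have "parking_of B v < card ?D"
    using threshold_potential_depth[OF B] v(1) A by (auto simp: threshold_potential_def)
  ultimately show "\<exists>v\<in>A. parking_of B v < card {a \<in> arcs G. tail G a \<in> verts G - A \<and> head G a = v}"
    using v(1) by (intro bexI[of _ v]) auto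
qed

lemma tree_arcs_eqI:
  assumes "tree_arcs B" "tree_arcs C" "\<And>v. v \<in> verts G \<Longrightarrow> depth B v = depth C v"
  shows "B = C"
proof -
  have "a \<in> B \<longleftrightarrow> a \<in> C" if "a \<in> arcs G" for a
    using that assms(3) depth_head_eq_iff[OF assms(1)] depth_head_eq_iff[OF assms(2)] by simp
  then show ?thesis using assms(1,2) unfolding tree_arcs_def by blast
qed

text \<open>One arc of \<open>B\<close> enters each vertex other than \<open>s\<close>, and
  \<open>d\<close> strictly drops when it is traversed backwards, so walking back ends at
  \<open>s\<close>.\<close>

lemma tree_arcs_of_potential:
  fixes d :: "'a \<Rightarrow> nat"
  assumes bij: "bij_betw (head G) B (verts G - {s})" and BG: "B \<subseteq> arcs G"
    and d: "\<And>a. a \<in> B \<Longrightarrow> d (head G a) = d (tail G a) + weight a"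
  shows "tree_arcs B"
proof -
  \<comment> \<open>The bound on the heads is carried along so that the arc appended at
    \<open>v\<close> is seen to be new.\<close>
  have ex: "\<exists>p. set p \<subseteq> B \<and> cas s p v \<and> distinct p \<and> (\<forall>a\<in>set p. d (head G a) \<le> d v)"
    if "v \<in> verts G" for v
    using that
  proof (induction "d v" arbitrary: v rule: less_induct)
    case less
    show ?case
    proof (cases "v = s")
      case True
      then show ?thesis by (intro exI[of _ "[]"]) simp
    next
      case False
      then have "v \<in> head G ` B" using bij_betw_imp_surj_on[OF bij] less.prems by simp
      then obtain a where a: "a \<in> B" "head G a = v" by blast
      have lt: "d (tail G a) < d v" using d[OF a(1)] a(2) by simp
      moreover have "tail G a \<in> verts G" using a BG by auto
      ultimately obtain p where p: "set p \<subseteq> B" "cas s p (tail G a)" "distinct p"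
        "\<forall>b\<in>set p. d (head G b) \<le> d (tail G a)"
        using less.hyps by blast
      have "a \<notin> set p" using p(4) lt a(2) by auto
      then show ?thesis
        using p a lt by (intro exI[of _ "p @ [a]"]) (auto simp: cas_snoc_iff simp del: cas_append_iff)
    qed
  qed
  have no_root: "head G a \<noteq> s" if "a \<in> B" for a
    using bij that by (auto simp: bij_betw_def)
  \<comment> \<open>Walks are compared from the end: the last arc is determined by its head, and no
    arc of \<open>B\<close> enters \<open>s\<close>.\<close>
  have uniq: "p = q" if "set p \<subseteq> B" "cas s p v" "set q \<subseteq> B" "cas s q v" for p q v
    using that
  proof (induction p arbitrary: q v rule: rev_induct)
    case Nil
    then show ?case using no_root by (cases q rule: rev_cases) auto
  next
    case (snoc a p)
    then have "a \<in> B" "head G a = v" by (simp_all add: cas_snoc_iff del: cas_append_iff)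
    then have "q \<noteq> []" using no_root[of a] snoc.prems(4) by auto
    then obtain q' b where q: "q = q' @ [b]" by (cases q rule: rev_cases) auto
    then have "a = b" using snoc.prems bij by (auto simp: bij_betw_def inj_on_def)
    moreover from this have "p = q'" using snoc.prems q by (intro snoc.IH[of "tail G a"]) auto
    ultimately show ?case using q by simp
  qed
  have "\<exists>!p. set p \<subseteq> B \<and> cas s p v \<and> distinct p" if "v \<in> verts G" for v
    using ex[OF that] uniq by blast
  then show ?thesis using BG by (simp add: tree_arcs_def)
qed

text \<open>More than \<open>f v\<close> arcs into \<open>v\<close> have arrival value at most
  \<open>d v\<close>, but at most \<open>f v\<close> have a smaller one; so some arc
  \<open>\<pi> v\<close> attains \<open>d v\<close>. These arcs form the tree.\<close>

lemma parking_of_surj: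
  assumes f: "f \<in> parking_functions G s"
  obtains B where "tree_arcs B" "parking_of B = f"
proof -
  obtain d where d: "threshold_potential f d" using threshold_potential_exists[OF f] .
  let ?in = "\<lambda>v k. {a \<in> arcs G. head G a = v \<and> d (tail G a) + weight a \<le> k}"
  let ?lt = "\<lambda>v. {a \<in> arcs G. head G a = v \<and> d (tail G a) + weight a < d v}"
  have ge: "f v < card (?in v (d v))" if "v \<in> verts G - {s}" for v
    using d that by (auto simp: threshold_potential_def)
  have le: "card (?lt v) \<le> f v" if "v \<in> verts G - {s}" for v
  proof (cases "d v")
    case 0
    then show ?thesis by simp
  next
    case (Suc k)
    then have "?lt v = ?in v k" by auto
    moreover have "d v \<le> k \<longleftrightarrow> f v < card (?in v k)"
      using d that unfolding threshold_potential_def by blast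
    ultimately show ?thesis using Suc by simp
  qed
  have "\<exists>a\<in>arcs G. head G a = v \<and> d v = d (tail G a) + weight a" if "v \<in> verts G - {s}" for v
  proof (rule ccontr)
    assume "\<not> ?thesis"
    then have "?in v (d v) = ?lt v" by (auto simp: le_less)
    then show False using ge[OF that] le[OF that] by simp
  qed
  then obtain \<pi> where \<pi>: "\<And>v. v \<in> verts G - {s} \<Longrightarrow>
      \<pi> v \<in> arcs G \<and> head G (\<pi> v) = v \<and> d v = d (tail G (\<pi> v)) + weight (\<pi> v)"
    by metis
  define B where "B = \<pi> ` (verts G - {s})"
  have bij: "bij_betw (head G) B (verts G - {s})"
  proof (rule bij_betw_imageI)
    show "inj_on (head G) B" using \<pi> by (auto simp: inj_on_def B_def)
    have "(head G \<circ> \<pi>) ` (verts G - {s}) = id ` (verts G - {s})"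
      using \<pi> by (intro image_cong) auto
    then show "head G ` B = verts G - {s}" by (simp add: B_def image_comp)
  qed
  have dB: "d (head G a) = d (tail G a) + weight a" if "a \<in> B" for a
  proof -
    obtain v where "v \<in> verts G - {s}" "a = \<pi> v" using \<open>a \<in> B\<close> unfolding B_def by blast
    then show ?thesis using \<pi>[of v] by simp
  qed
  have "B \<subseteq> arcs G" using \<pi> unfolding B_def by blast
  from tree_arcs_of_potential[OF bij this dB] have B: "tree_arcs B" .
  have depth: "depth B v = d v" if v: "v \<in> verts G" for v
  proof -
    let ?p = "tree_path B v"
    have p: "set ?p \<subseteq> B" "cas s ?p v" "distinct ?p"
      using tree_path_subset cas_tree_path distinct_tree_path B v by auto
    have "int (depth B v) = (\<Sum>a\<in>set ?p. int (d (head G a)) - int (d (tail G a)))"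
      unfolding depth_def of_nat_sum using p(1) dB by (intro sum.cong) auto
    also have "\<dots> = int (d v) - int (d s)"
      using p(3) sum_list_cas_telescope[OF p(2), of "\<lambda>x. int (d x)"]
      by (simp add: sum_list_distinct_conv_sum_set)
    finally show ?thesis using d by (simp add: threshold_potential_def)
  qed
  have "parking_of B v = f v" for v
  proof (cases "v \<in> verts G - {s}")
    case True
    have lt: "inactive_in B v = ?lt v" using depth True by (auto simp: inactive_in_def)
    \<comment> \<open>As \<open>d\<close> is the depth, an arc with arrival value exactly
      \<open>d v\<close> lies in \<open>B\<close> and is therefore \<open>\<pi> v\<close>. This
      single tight arc leaves at least \<open>f v\<close> arcs strictly below
      \<open>d v\<close>.\<close>
    have "?in v (d v) \<subseteq> insert (\<pi> v) (?lt v)"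
    proof
      fix a assume a: "a \<in> ?in v (d v)"
      show "a \<in> insert (\<pi> v) (?lt v)"
      proof (cases "d (tail G a) + weight a = d v")
        case True
        then have "a \<in> B" using a depth_head_eq_iff[OF B, of a] depth by auto
        then obtain u where "u \<in> verts G - {s}" "a = \<pi> u" unfolding B_def by blast
        then have "a = \<pi> v" using a \<pi>[of u] by simp
        then show ?thesis by simp
      qed (use a in auto)
    qed
    then have "card (?in v (d v)) \<le> card (insert (\<pi> v) (?lt v))" by (intro card_mono) auto
    also have "\<dots> \<le> Suc (card (?lt v))" by (rule card_insert_le_m1) auto
    finally show ?thesis using ge[OF True] le[OF True] True lt by (simp add: parking_of_def)
  next
    case False
    then show ?thesis using f unfolding parking_functions_def parking_of_def
      by (auto simp: PiE_def extensional_def)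
  qed
  then show ?thesis using B that by blast
qed

text \<open>Injectivity: a parking function determines its threshold potential on the vertices, that
  is the depth, and the depth determines the tree.\<close>

lemma bij_betw_parking_of: "bij_betw parking_of {B. tree_arcs B} (parking_functions G s)"
proof (rule bij_betw_imageI)
  show "inj_on parking_of {B. tree_arcs B}"
  proof (rule inj_onI)
    fix B C assume "B \<in> {B. tree_arcs B}" "C \<in> {B. tree_arcs B}"
      and eq: "parking_of B = parking_of C"
    then have B: "tree_arcs B" and C: "tree_arcs C" by simp_all
    show "B = C"
      using threshold_potential_depth[OF B] threshold_potential_depth[OF C] unfolding eq
      by (intro tree_arcs_eqI[OF B C] threshold_potential_unique)
  qed
  show "parking_of ` {B. tree_arcs B} = parking_functions G s"
  proof (intro equalityI subsetI)
    fix f assume "f \<in> parking_functions G s"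
    then obtain B where "tree_arcs B" "parking_of B = f" by (rule parking_of_surj)
    then show "f \<in> parking_of ` {B. tree_arcs B}" by blast
  qed (use parking_of_mem in auto)
qed

text \<open>Comparing depths splits the arcs into active, inactive and tree arcs. The values of the
  parking function add up to the number of inactive ones and the tree has one arc per vertex other
  than \<open>s\<close>, so the d-level counts the active ones.\<close>

lemma dlvl_parking_of:
  assumes B: "tree_arcs B"
  shows "dlvl G s (parking_of B) = int (external_activity G R (G\<lparr>arcs := B\<rparr>))"
proof -
  let ?act = "{e. externally_active G R (G\<lparr>arcs := B\<rparr>) e}"
  let ?inact = "\<Union>v\<in>verts G - {s}. inactive_in B v"
  have BG: "B \<subseteq> arcs G" using B by (simp add: tree_arcs_def)
  then have finB: "finite B" by (rule finite_subset) simp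
  have inact: "?inact = {a \<in> arcs G. depth B (tail G a) + weight a < depth B (head G a)}"
  proof -
    have "head G a \<noteq> s" if "depth B (tail G a) + weight a < depth B (head G a)" for a
      using that depth_root[OF B] by (metis not_less_zero)
    then show ?thesis by (auto simp: inactive_in_def)
  qed
  have act: "?act = {a \<in> arcs G. depth B (head G a) < depth B (tail G a) + weight a}"
    using externally_active_iff[OF B] by auto
  have tree: "B = {a \<in> arcs G. depth B (head G a) = depth B (tail G a) + weight a}"
    using depth_head_eq_iff[OF B] BG by auto
  have split: "arcs G = ?act \<union> (?inact \<union> B)" unfolding inact act by (subst (2) tree) auto
  have disj: "?act \<inter> (?inact \<union> B) = {}" "?inact \<inter> B = {}"
    unfolding inact act by (subst tree; auto)+
  have fin: "finite ?act" "finite ?inact" unfolding inact act by auto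
  have "card (arcs G) = card ?act + card ?inact + card B"
    using fin finB disj by (subst split) (simp add: card_Un_disjoint)
  moreover have "card ?inact = (\<Sum>v\<in>verts G - {s}. parking_of B v)"
    unfolding parking_of_def
    by (subst card_UN_disjoint) (auto simp: inactive_in_def)
  moreover have "card B = card (verts G) - 1"
    using bij_betw_same_card[OF bij_betw_head_tree_arcs[OF B]] root_in_verts by simp
  \<comment> \<open>Makes the truncated subtraction of 1 above a genuine one.\<close>
  moreover have "card (verts G) \<ge> 1"
    using root_in_verts by (metis One_nat_def Suc_leI card_gt_0_iff empty_iff finite_verts)
  ultimately show ?thesis
    by (simp add: dlvl_def external_activity_def of_nat_sum[symmetric] del: of_nat_sum)
qed

section \<open>Coefficients of the greedoid Tutte polynomial\<close>

lemma card_Park: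
  "card (Park G s n) = card {T \<in> arborescences G s. external_activity G R T = n}"
proof -
  let ?S = "{B. tree_arcs B \<and> external_activity G R (G\<lparr>arcs := B\<rparr>) = n}"
  have bij: "bij_betw parking_of ?S (Park G s n)"
    using bij_betw_parking_of dlvl_parking_of
    by (fastforce simp: bij_betw_def Park_def inj_on_def)
  have eq: "{T \<in> arborescences G s. external_activity G R T = n} = (\<lambda>B. G\<lparr>arcs := B\<rparr>) ` ?S"
    unfolding arborescences_eq by auto
  have inj: "inj_on (\<lambda>B. G\<lparr>arcs := B\<rparr>) ?S"
    by (rule inj_onI)
      (metis pre_digraph.select_convs(2) pre_digraph.surjective pre_digraph.update_convs(2))
  show ?thesis using bij_betw_same_card[OF bij] card_image[OF inj] by (simp only: eq)
qed

lemma coeff_greedoid_tutte_poly: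
  "coeff (greedoid_tutte_poly G R s) n = int (card (Park G s n))"
proof -
  have "coeff (greedoid_tutte_poly G R s) n =
      (\<Sum>T\<in>arborescences G s. if external_activity G R T = n then 1 else 0)"
    by (simp add: greedoid_tutte_poly_def coeff_sum)
  also have "\<dots> = int (card {T \<in> arborescences G s. external_activity G R T = n})"
    using finite_arborescences[OF finite_arcs] by (simp add: sum.If_cases Int_def)
  finally show ?thesis by (simp add: card_Park)
qed

end

theorem theorem6p7:
  fixes G :: "('a,'b) pre_digraph" and s :: 'a and R :: "'b rel"
  assumes "fin_digraph G"
    and "strongly_connected G"
    and "s \<in> verts G"
    and "linear_order_on (arcs G) R"
  shows "fps_of_poly (greedoid_tutte_poly G R s) = Abs_fps (\<lambda>n. int (card (Park G s n)))"
proof -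
  interpret ordered_rooted_digraph G s R
    using assms by (simp add: ordered_rooted_digraph_def ordered_rooted_digraph_axioms_def)
  show ?thesis
    by (rule fps_ext) (simp add: coeff_greedoid_tutte_poly)
qed

end
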